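(* Let $\eta>0$ be a constant, let $\bm r\in\mathbb R^l$, let $\kappa:\mathbb R^n\times\mathbb R^l\to\mathbb R^m$ be a nominal control policy and let $\rho:\mathbb R^l\times\mathbb R^l\to\mathbb R^l$ be a navigation field. If $\Delta:\tilde{\mathcal D}\to\mathbb R^{n_c}$ is a dynamic safety margin (DSM), then there exists a class $\mathscr K$ function $\alpha$ such that the optimization-based policy $\tilde\beta:\tilde{\mathcal C}\to\mathcal U\times\mathbb R^l$, $$\tilde\beta(\bm x,\bm v)=\operatorname*{argmin}_{(\bm u,\bm w)\in\tilde{\mathcal K}_\alpha(\bm x,\bm v)}\ \|\bm u-\kappa(\bm x,\bm r)\|^2+\eta\,\|\bm w-\rho(\bm v,\bm r)\|^2,$$ is feasible for all $(\bm x,\bm v)\in\tilde{\mathcal C}$ (that is, $\tilde{\mathcal K}_\alpha(\bm x,\bm v)\neq\emptyset$). Moreover, if $\tilde\beta$ is locally Lipschitz continuous and $\Delta$ satisfies the MFCQ, then, for every initial condition $(x(0),v(0))\in\tilde{\mathcal C}$, the trajectory of the augmented system $\dot{\bm x}=f(\bm x)+g(\bm x)\bm u$, $\dot{\bm v}=\bm w$ under the policy $(\bm u,\bm w)=\tilde\beta(\bm x,\bm v)$ exists, is unique, and satisfies $x(t)\in\mathcal X$ and $v(t)\in\mathcal V$ for all $t\ge 0$.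
   Context: Class $\mathscr K$: continuous strictly increasing $\alpha:[0,\infty)\to[0,\infty)$ with $\alpha(0)=0$. System: $\dot{\bm x}=f(\bm x)+g(\bm x)\bm u$, with $f:\mathbb R^n\to\mathbb R^n$ and $g:\mathbb R^n\to\mathbb R^{n\times m}$ locally Lipschitz, subject to $\bm x\in\mathcal X$, $\bm u\in\mathcal U$, where $\mathcal X\subset\mathbb R^n$ and $\mathcal U\subset\mathbb R^m$ are closed. Equilibria: there is a simply connected manifold of stabilizable equilibria parameterized by continuous $\bar x:\mathbb R^l\to\mathbb R^n$, $\bar u:\mathbb R^l\to\mathbb R^m$ with $f(\bar x(\bm v))+g(\bar x(\bm v))\bar u(\bm v)=0$ for all $\bm v\in\mathbb R^l$. The set of steady-state admissible references $\mathcal V=\{\bm v\in\mathbb R^l\mid \bar x(\bm v)\in\mathcal X,\ \bar u(\bm v)\in\mathcal U\}$ is assumed nonempty. Prestabilizing controller: $\pi:\mathbb R^n\times\mathbb R^l\to\mathbb R^m$ is jointly continuous and locally Lipschitz in its first argument, $\pi(\bar x(\bm v),\bm v)=\bar u(\bm v)$, and for each fixed $\bm v$ the point $\bar x(\bm v)$ is an asymptotically stable equilibrium of $\dot{\bm x}=f_\pi(\bm x,\bm v):=f(\bm x)+g(\bm x)\pi(\bm x,\bm v)$. For each $\bm v$, $\mathcal D_{\bm v}\subset\mathbb R^n$ is an open set containing $\bar x(\bm v)$ such that solutions of $\dot{\bm x}=f_\pi(\bm x,\bm v)$ starting in $\mathcal D_{\bm v}$ converge to $\bar x(\bm v)$.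 The set $\tilde{\mathcal D}=\{(\bm x,\bm v)\in\mathbb R^n\times\mathbb R^l\mid \bm x\in\mathcal D_{\bm v}\}$ is assumed open in $\mathbb R^n\times\mathbb R^l$. Constraint sets: $\mathcal X_{\bm v}=\{\bm x\in\mathcal X\mid \pi(\bm x,\bm v)\in\mathcal U\}$ and $\tilde{\mathcal X}=\{(\bm x,\bm v)\in\mathbb R^n\times\mathbb R^l\mid \bm x\in\mathcal X_{\bm v},\ \bm v\in\mathcal V\}$. DSM: a continuously differentiable $\Delta:\tilde{\mathcal D}\to\mathbb R^{n_c}$ with components $\Delta_i$ is a dynamic safety margin if, with $\tilde{\mathcal C}=\{(\bm x,\bm v)\in\tilde{\mathcal D}\mid \Delta(\bm x,\bm v)\ge 0\}$ (componentwise inequality): (i) $\tilde{\mathcal C}\subset\tilde{\mathcal X}$; (ii) $\tilde{\mathcal C}$ is compact in $\mathbb R^n\times\mathbb R^l$; (iii) for every $i\in\{1,\dots,n_c\}$ and $(\bm x,\bm v)\in\tilde{\mathcal D}$, $\Delta_i(\bm x,\bm v)=0$ implies $\frac{\partial\Delta_i}{\partial\bm x}(\bm x,\bm v)f_\pi(\bm x,\bm v)\ge 0$. Viable inputs: $\tilde{\mathcal K}_\alpha(\bm x,\bm v)$ is the set of $(\bm u,\bm w)\in\mathcal U\times\mathbb R^l$ with $\min_{i}\big[\dot\Delta_i(\bm x,\bm v,\bm u,\bm w)+\alpha(\Delta_i(\bm x,\bm v))\big]\ge 0$, where $\dot\Delta_i(\bm x,\bm v,\bm u,\bm w)=\frac{\partial\Delta_i}{\partial\bm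 x}(\bm x,\bm v)(f(\bm x)+g(\bm x)\bm u)+\frac{\partial\Delta_i}{\partial\bm v}(\bm x,\bm v)\bm w$. MFCQ: $\Delta$ satisfies the MFCQ if for every $(\bm x,\bm v)\in\tilde{\mathcal D}$ there is $\bm z\in\mathbb R^{n+l}$ with $\frac{\partial\Delta_i}{\partial(\bm x,\bm v)}(\bm x,\bm v)\,\bm z>0$ for all $i$ with $\Delta_i(\bm x,\bm v)=0$. Navigation field: a locally Lipschitz $\rho:\mathbb R^l\times\mathbb R^l\to\mathbb R^l$ such that $\bm r$ is an asymptotically stable equilibrium of $\dot{\bm v}=\rho(\bm v,\bm r)$. Saying "$\tilde\beta$ is locally Lipschitz" includes that it is a well-defined single-valued function on $\tilde{\mathcal C}$. *)

theory Defs
  imports "HOL-Analysis.Analysis"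
begin

text \<open>A function of class K lives on the half-line; only its values on \<open>{0..}\<close> are constrained
  (nonnegativity there follows from monotonicity and the value at 0).\<close>

definition class_K :: "(real \<Rightarrow> real) \<Rightarrow> bool" where
  "class_K \<alpha> \<longleftrightarrow> continuous_on {0..} \<alpha> \<and> strict_mono_on {0..} \<alpha> \<and> \<alpha> 0 = 0"

definition locally_lipschitz_on :: "'a::metric_space set \<Rightarrow> ('a \<Rightarrow> 'b::metric_space) \<Rightarrow> bool" where
  "locally_lipschitz_on S F \<longleftrightarrow> (\<forall>p\<in>S. \<exists>e>0. \<exists>L. L-lipschitz_on (cball p e \<inter> S) F)"

text \<open>Intended for open \<open>S\<close>: derivatives are taken at the point, not within \<open>S\<close>.\<close>

definition continuously_differentiable_on ::
    "'a::real_normed_vector set \<Rightarrow> ('a \<Rightarrow> 'b::real_normed_vector) \<Rightarrow> bool" where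
  "continuously_differentiable_on S F \<longleftrightarrow>
     (\<exists>F'. (\<forall>p\<in>S. (F has_derivative blinfun_apply (F' p)) (at p)) \<and> continuous_on S F')"

text \<open>A locally Euclidean subset of a Euclidean space. The model space of the charts is a linear
  subspace \<open>S\<close> of the ambient space, so that its dimension is not tied to a type.\<close>

definition topological_manifold :: "'a::euclidean_space set \<Rightarrow> bool" where
  "topological_manifold M \<longleftrightarrow>
     (\<exists>S::'a set. subspace S \<and>
        (\<forall>p\<in>M. \<exists>W. openin (top_of_set M) W \<and> p \<in> W \<and> W homeomorphic S))"

definition initial_interval :: "real set \<Rightarrow> bool" where
  "initial_interval I \<longleftrightarrow> is_interval I \<and> 0 \<in> I \<and> I \<subseteq> {0..}"

definition ode_solution ::
    "('a::real_normed_vector \<Rightarrow> 'a) \<Rightarrow> real set \<Rightarrow> (real \<Rightarrow> 'a) \<Rightarrow> bool" where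
  "ode_solution F I x \<longleftrightarrow> (\<forall>t\<in>I. (x has_vector_derivative F (x t)) (at t within I))"

text \<open>Convergence of the solutions from \<open>x\<^sub>0\<close> includes that they are defined for all
  nonnegative times; without the first conjunct, finite escape would satisfy it vacuously.\<close>

definition solutions_converge ::
    "('a::real_normed_vector \<Rightarrow> 'a) \<Rightarrow> 'a \<Rightarrow> 'a \<Rightarrow> bool" where
  "solutions_converge F x\<^sub>0 xe \<longleftrightarrow>
     (\<exists>x. ode_solution F {0..} x \<and> x 0 = x\<^sub>0) \<and>
     (\<forall>x. ode_solution F {0..} x \<and> x 0 = x\<^sub>0 \<longrightarrow> (x \<longlongrightarrow> xe) at_top)"

definition lyapunov_stable :: "('a::real_normed_vector \<Rightarrow> 'a) \<Rightarrow> 'a \<Rightarrow> bool" where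
  "lyapunov_stable F xe \<longleftrightarrow>
     (\<forall>\<epsilon>>0. \<exists>\<delta>>0. \<forall>I x. initial_interval I \<and> ode_solution F I x \<and> dist (x 0) xe < \<delta>
        \<longrightarrow> (\<forall>t\<in>I. dist (x t) xe < \<epsilon>))"

definition asymptotically_stable_equilibrium ::
    "('a::real_normed_vector \<Rightarrow> 'a) \<Rightarrow> 'a \<Rightarrow> bool" where
  "asymptotically_stable_equilibrium F xe \<longleftrightarrow>
     F xe = 0 \<and> lyapunov_stable F xe \<and>
     (\<exists>\<delta>>0. \<forall>x\<^sub>0. dist x\<^sub>0 xe < \<delta> \<longrightarrow> solutions_converge F x\<^sub>0 xe)"

text \<open>Here \<open>f\<close> and \<open>g\<close> are the drift and the input matrix, \<open>pol\<close> is the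
  prestabilizing controller, and \<open>D v\<close> is the chosen set of attraction for the reference \<open>v\<close>.\<close>

definition admissible_references ::
    "(real^'n) set \<Rightarrow> (real^'m) set \<Rightarrow> (real^'l \<Rightarrow> real^'n) \<Rightarrow> (real^'l \<Rightarrow> real^'m) \<Rightarrow> (real^'l) set"
  where "admissible_references X U xbar ubar = {v. xbar v \<in> X \<and> ubar v \<in> U}"

definition prestabilized ::
    "(real^'n \<Rightarrow> real^'n) \<Rightarrow> (real^'n \<Rightarrow> real^'m^'n) \<Rightarrow> (real^'n \<Rightarrow> real^'l \<Rightarrow> real^'m)
      \<Rightarrow> real^'n \<Rightarrow> real^'l \<Rightarrow> real^'n"
  where "prestabilized f g pol x v = f x + g x *v pol x v"

definition attraction_domain :: "(real^'l \<Rightarrow> (real^'n) set) \<Rightarrow> ((real^'n) \<times> (real^'l)) set" where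
  "attraction_domain D = {(x, v). x \<in> D v}"

definition constraint_slice ::
    "(real^'n) set \<Rightarrow> (real^'m) set \<Rightarrow> (real^'n \<Rightarrow> real^'l \<Rightarrow> real^'m) \<Rightarrow> real^'l \<Rightarrow> (real^'n) set"
  where "constraint_slice X U pol v = {x \<in> X. pol x v \<in> U}"

definition constraint_set ::
    "(real^'n) set \<Rightarrow> (real^'m) set \<Rightarrow> (real^'l \<Rightarrow> real^'n) \<Rightarrow> (real^'l \<Rightarrow> real^'m)
      \<Rightarrow> (real^'n \<Rightarrow> real^'l \<Rightarrow> real^'m) \<Rightarrow> ((real^'n) \<times> (real^'l)) set"
  where "constraint_set X U xbar ubar pol =
    {(x, v). x \<in> constraint_slice X U pol v \<and> v \<in> admissible_references X U xbar ubar}"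

definition navigation_field :: "(real^'l \<Rightarrow> real^'l \<Rightarrow> real^'l) \<Rightarrow> real^'l \<Rightarrow> bool" where
  "navigation_field \<rho> r \<longleftrightarrow>
     locally_lipschitz_on UNIV (\<lambda>(v, r'). \<rho> v r') \<and>
     asymptotically_stable_equilibrium (\<lambda>v. \<rho> v r) r"

text \<open>The margin \<open>\<Delta>\<close> is a total function in HOL, but only its values
  on the open set \<open>attraction_domain D\<close> matter.\<close>

definition safe_set ::
    "(real^'l \<Rightarrow> (real^'n) set) \<Rightarrow> ((real^'n) \<times> (real^'l) \<Rightarrow> real^'c) \<Rightarrow> ((real^'n) \<times> (real^'l)) set" where
  "safe_set D \<Delta> = {p \<in> attraction_domain D. \<forall>i. \<Delta> p $ i \<ge> 0}"

definition partial_x ::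
    "((real^'n) \<times> (real^'l) \<Rightarrow> real^'c) \<Rightarrow> 'c \<Rightarrow> real^'n \<Rightarrow> real^'l \<Rightarrow> real^'n \<Rightarrow> real" where
  "partial_x \<Delta> i x v = frechet_derivative (\<lambda>\<xi>. \<Delta> (\<xi>, v) $ i) (at x)"

definition partial_v ::
    "((real^'n) \<times> (real^'l) \<Rightarrow> real^'c) \<Rightarrow> 'c \<Rightarrow> real^'n \<Rightarrow> real^'l \<Rightarrow> real^'l \<Rightarrow> real" where
  "partial_v \<Delta> i x v = frechet_derivative (\<lambda>\<nu>. \<Delta> (x, \<nu>) $ i) (at v)"

definition dynamic_safety_margin ::
    "(real^'n \<Rightarrow> real^'n) \<Rightarrow> (real^'n \<Rightarrow> real^'m^'n) \<Rightarrow> (real^'n) set \<Rightarrow> (real^'m) set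
      \<Rightarrow> (real^'l \<Rightarrow> real^'n) \<Rightarrow> (real^'l \<Rightarrow> real^'m) \<Rightarrow> (real^'n \<Rightarrow> real^'l \<Rightarrow> real^'m)
      \<Rightarrow> (real^'l \<Rightarrow> (real^'n) set) \<Rightarrow> ((real^'n) \<times> (real^'l) \<Rightarrow> real^'c) \<Rightarrow> bool" where
  "dynamic_safety_margin f g X U xbar ubar pol D \<Delta> \<longleftrightarrow>
     continuously_differentiable_on (attraction_domain D) \<Delta> \<and>
     safe_set D \<Delta> \<subseteq> constraint_set X U xbar ubar pol \<and>
     compact (safe_set D \<Delta>) \<and>
     (\<forall>i. \<forall>(x, v) \<in> attraction_domain D.
        \<Delta> (x, v) $ i = 0 \<longrightarrow> partial_x \<Delta> i x v (prestabilized f g pol x v) \<ge> 0)"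

definition margin_rate ::
    "(real^'n \<Rightarrow> real^'n) \<Rightarrow> (real^'n \<Rightarrow> real^'m^'n) \<Rightarrow> ((real^'n) \<times> (real^'l) \<Rightarrow> real^'c)
      \<Rightarrow> 'c \<Rightarrow> real^'n \<Rightarrow> real^'l \<Rightarrow> real^'m \<Rightarrow> real^'l \<Rightarrow> real" where
  "margin_rate f g \<Delta> i x v u w = partial_x \<Delta> i x v (f x + g x *v u) + partial_v \<Delta> i x v w"

definition viable_inputs ::
    "(real^'n \<Rightarrow> real^'n) \<Rightarrow> (real^'n \<Rightarrow> real^'m^'n) \<Rightarrow> (real^'m) set
      \<Rightarrow> ((real^'n) \<times> (real^'l) \<Rightarrow> real^'c) \<Rightarrow> (real \<Rightarrow> real) \<Rightarrow> real^'n \<Rightarrow> real^'l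
      \<Rightarrow> ((real^'m) \<times> (real^'l)) set" where
  "viable_inputs f g U \<Delta> \<alpha> x v =
     {(u, w). u \<in> U \<and> (MIN i. margin_rate f g \<Delta> i x v u w + \<alpha> (\<Delta> (x, v) $ i)) \<ge> 0}"

definition satisfies_MFCQ ::
    "(real^'l \<Rightarrow> (real^'n) set) \<Rightarrow> ((real^'n) \<times> (real^'l) \<Rightarrow> real^'c) \<Rightarrow> bool" where
  "satisfies_MFCQ D \<Delta> \<longleftrightarrow>
     (\<forall>p \<in> attraction_domain D. \<exists>z. \<forall>i. \<Delta> p $ i = 0 \<longrightarrow>
        frechet_derivative (\<lambda>q. \<Delta> q $ i) (at p) z > 0)"

definition policy_cost ::
    "real \<Rightarrow> (real^'n \<Rightarrow> real^'l \<Rightarrow> real^'m) \<Rightarrow> (real^'l \<Rightarrow> real^'l \<Rightarrow> real^'l) \<Rightarrow> real^'l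
      \<Rightarrow> real^'n \<Rightarrow> real^'l \<Rightarrow> (real^'m) \<times> (real^'l) \<Rightarrow> real" where
  "policy_cost \<eta> \<kappa> \<rho> r x v = (\<lambda>(u, w). (norm (u - \<kappa> x r))\<^sup>2 + \<eta> * (norm (w - \<rho> v r))\<^sup>2)"

text \<open>\<open>\<beta>\<close> is the argmin policy on \<open>safe_set D \<Delta>\<close>: at each point the set of minimizers is the
  singleton of the value of \<open>\<beta>\<close>, so single-valuedness of the argmin is part of the notion.\<close>

definition is_argmin_policy ::
    "(real^'n \<Rightarrow> real^'n) \<Rightarrow> (real^'n \<Rightarrow> real^'m^'n) \<Rightarrow> (real^'m) set
      \<Rightarrow> (real^'l \<Rightarrow> (real^'n) set) \<Rightarrow> ((real^'n) \<times> (real^'l) \<Rightarrow> real^'c) \<Rightarrow> (real \<Rightarrow> real)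
      \<Rightarrow> real \<Rightarrow> (real^'n \<Rightarrow> real^'l \<Rightarrow> real^'m) \<Rightarrow> (real^'l \<Rightarrow> real^'l \<Rightarrow> real^'l) \<Rightarrow> real^'l
      \<Rightarrow> ((real^'n) \<times> (real^'l) \<Rightarrow> (real^'m) \<times> (real^'l)) \<Rightarrow> bool" where
  "is_argmin_policy f g U D \<Delta> \<alpha> \<eta> \<kappa> \<rho> r \<beta> \<longleftrightarrow>
     (\<forall>(x, v) \<in> safe_set D \<Delta>.
        {q. is_arg_min (policy_cost \<eta> \<kappa> \<rho> r x v) (\<lambda>q. q \<in> viable_inputs f g U \<Delta> \<alpha> x v) q}
          = {\<beta> (x, v)})"

text \<open>Since a policy is only defined on a set \<open>C\<close> of augmented states, a trajectory under it
  has to take its values in \<open>C\<close> for the right-hand side to make sense.\<close>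

definition closed_loop_trajectory ::
    "(real^'n \<Rightarrow> real^'n) \<Rightarrow> (real^'n \<Rightarrow> real^'m^'n) \<Rightarrow> ((real^'n) \<times> (real^'l)) set
      \<Rightarrow> ((real^'n) \<times> (real^'l) \<Rightarrow> (real^'m) \<times> (real^'l)) \<Rightarrow> real set
      \<Rightarrow> (real \<Rightarrow> real^'n) \<Rightarrow> (real \<Rightarrow> real^'l) \<Rightarrow> bool" where
  "closed_loop_trajectory f g C \<beta> I x v \<longleftrightarrow>
     (\<forall>t\<in>I. (x t, v t) \<in> C \<and>
        (let (u, w) = \<beta> (x t, v t) in
           (x has_vector_derivative f (x t) + g (x t) *v u) (at t within I) \<and>
           (v has_vector_derivative w) (at t within I)))"

end

theory Submission
  imports Defs
begin

text \<open>Holding the reference still and applying the prestabilizing controller costs at most a rate that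
  vanishes where the margin vanishes; by compactness of the safe set this rate is bounded by a class K
  function of the margin, which makes the controller input viable. For invariance, the closed-loop
  field, Lipschitz on the compact safe set, is extended to a Lipschitz field on the whole space, whose
  solutions are global. MFCQ lets one tilt the field strictly inward at any safe point by an arbitrarily
  small amount, so the field is subtangential to the safe set, and a Gronwall estimate for the distance
  to the safe set (Nagumo's argument) keeps the solution inside.\<close>

subsection \<open>Lipschitz functions\<close>

lemma locally_lipschitz_on_compact:
  assumes "locally_lipschitz_on S F" and "compact S"
  obtains L where "L-lipschitz_on S F"
proof -
  \<comment> \<open>\<open>local_lipschitz\<close> speaks of time-dependent fields; a field constant
    in time over the single time 0 carries the compactness argument over.\<close>
  have "local_lipschitz {0::real} S (\<lambda>_. F)"
    unfolding local_lipschitz_def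
  proof (intro ballI)
    fix p and t :: real assume "p \<in> S" "t \<in> {0}"
    then obtain e L where e: "e > 0" and L: "L-lipschitz_on (cball p e \<inter> S) F"
      using assms(1) unfolding locally_lipschitz_on_def by blast
    show "\<exists>u>0. \<exists>L. \<forall>t\<in>cball t u \<inter> {0}. L-lipschitz_on (cball p u \<inter> S) F"
      using e L by blast
  qed
  then obtain L where "\<And>t. t \<in> {0::real} \<Longrightarrow> L-lipschitz_on S F"
    using assms(2) by (elim local_lipschitz_compact_implies_lipschitz) (auto intro: that)
  then show thesis using that by blast
qed

lemma locally_lipschitz_on_subset:
  "locally_lipschitz_on S F \<Longrightarrow> T \<subseteq> S \<Longrightarrow> locally_lipschitz_on T F"
  unfolding locally_lipschitz_on_def
  by (meson Int_mono lipschitz_on_subset order_refl subset_iff)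

lemma locally_lipschitz_on_continuous_on:
  assumes "locally_lipschitz_on S F"
  shows "continuous_on S F"
  unfolding continuous_on_eq_continuous_within
proof
  fix p assume p: "p \<in> S"
  then obtain e L where e: "e > 0" and L: "L-lipschitz_on (cball p e \<inter> S) F"
    using assms unfolding locally_lipschitz_on_def by blast
  have "continuous (at p within (cball p e \<inter> S)) F"
    using L p e by (intro lipschitz_on_continuous_within[OF L]) auto
  moreover have "at p within (cball p e \<inter> S) = at p within S"
    using e by (intro at_within_nhd[of p "ball p e"]) auto
  ultimately show "continuous (at p within S) F" by simp
qed

lemma lipschitz_on_fst: "1-lipschitz_on S fst"
  by (rule lipschitz_onI) (auto simp: dist_fst_le)

lemma lipschitz_on_snd: "1-lipschitz_on S snd"
  by (rule lipschitz_onI) (auto simp: dist_snd_le)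

text \<open>Puts the input term \<open>g x *v u\<close> under the general product rules: Lipschitz
  bounds for the closed loop, continuity for the prestabilized field.\<close>

lemma bounded_bilinear_matrix_vector_mult:
  "bounded_bilinear ((*v) :: real^'m^'n \<Rightarrow> real^'m \<Rightarrow> real^'n)"
proof
  fix A A' :: "real^'m^'n" and x x' :: "real^'m" and c :: real
  show "(A + A') *v x = A *v x + A' *v x" by (rule matrix_vector_mult_add_rdistrib)
  show "A *v (x + x') = A *v x + A *v x'" by (rule matrix_vector_right_distrib)
  show "(c *\<^sub>R A) *v x = c *\<^sub>R (A *v x)" by (rule scaleR_matrix_vector_assoc[symmetric])
  show "A *v (c *\<^sub>R x) = c *\<^sub>R (A *v x)" by (rule matrix_vector_mult_scaleR)
  show "\<exists>K. \<forall>(A::real^'m^'n) x. norm (A *v x) \<le> norm A * norm x * K"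
  \<comment> \<open>The norm is at most the sum of the absolute entries, and Cauchy-Schwarz bounds
    each of the \<open>CARD('n)\<close> entries by \<open>norm A * norm x\<close>.\<close>
  proof (intro exI[of _ "real CARD('n)"] allI)
    fix A :: "real^'m^'n" and x :: "real^'m"
    have "norm (A *v x) \<le> (\<Sum>i\<in>UNIV. \<bar>(A *v x) $ i\<bar>)" by (rule norm_le_l1_cart)
    also have "\<dots> \<le> (\<Sum>i\<in>(UNIV::'n set). norm A * norm x)"
    proof (rule sum_mono)
      fix i
      have "\<bar>(A *v x) $ i\<bar> \<le> norm (A $ i) * norm x"
        unfolding matrix_vector_mul_component by (rule Cauchy_Schwarz_ineq2)
      also have "\<dots> \<le> norm A * norm x" by (intro mult_right_mono Finite_Cartesian_Product.norm_nth_le) auto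
      finally show "\<bar>(A *v x) $ i\<bar> \<le> norm A * norm x" .
    qed
    finally show "norm (A *v x) \<le> norm A * norm x * real CARD('n)" by (simp add: mult.commute)
  qed
qed

text \<open>Varying one factor at a time splits the increment of the product into two terms, each a
  Lipschitz increment times a bounded factor.\<close>

lemma (in bounded_bilinear) lipschitz_on_prod:
  assumes F: "L-lipschitz_on S F" "bounded (F ` S)" and G: "M-lipschitz_on S G" "bounded (G ` S)"
  obtains N where "N-lipschitz_on S (\<lambda>p. prod (F p) (G p))"
proof -
  obtain K where K: "K > 0" "\<And>a b. norm (prod a b) \<le> norm a * norm b * K" using pos_bounded by blast
  obtain a b where a: "a > 0" "\<And>p. p \<in> S \<Longrightarrow> norm (F p) \<le> a" and b: "b > 0" "\<And>p. p \<in> S \<Longrightarrow> norm (G p) \<le> b"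
    using F(2) G(2) unfolding bounded_pos by auto
  have L0: "L \<ge> 0" "M \<ge> 0" using F G lipschitz_on_nonneg by blast+
  have "(L * b * K + a * M * K)-lipschitz_on S (\<lambda>p. prod (F p) (G p))"
  proof (rule lipschitz_onI)
    fix p q assume pq: "p \<in> S" "q \<in> S"
    have "prod (F p) (G p) - prod (F q) (G q) = prod (F p - F q) (G p) + prod (F q) (G p - G q)"
      by (simp add: diff_left diff_right)
    then have "dist (prod (F p) (G p)) (prod (F q) (G q)) \<le> norm (prod (F p - F q) (G p)) + norm (prod (F q) (G p - G q))"
      by (simp add: dist_norm norm_triangle_ineq)
    also have "\<dots> \<le> norm (F p - F q) * norm (G p) * K + norm (F q) * norm (G p - G q) * K"
      by (intro add_mono K)
    also have "\<dots> \<le> (L * dist p q) * b * K + a * (M * dist p q) * K"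
      using K(1) a b L0 pq lipschitz_onD[OF F(1) pq] lipschitz_onD[OF G(1) pq]
      by (intro add_mono mult_right_mono mult_mono) (auto simp: dist_norm)
    finally show "dist (prod (F p) (G p)) (prod (F q) (G q)) \<le> (L * b * K + a * M * K) * dist p q"
      by (simp add: algebra_simps)
  qed (use L0 K a b in simp)
  then show thesis by (rule that)
qed

text \<open>McShane extension\<close>

lemma lipschitz_extension_real:
  fixes F :: "'a::metric_space \<Rightarrow> real"
  assumes L: "L-lipschitz_on S F" and "S \<noteq> {}"
  shows "\<exists>G. L-lipschitz_on UNIV G \<and> (\<forall>x\<in>S. G x = F x)"
proof -
  define G where "G p = (INF q\<in>S. F q + L * dist p q)" for p
  have L0: "L \<ge> 0" using L by (rule lipschitz_on_nonneg)
  have lip: "F p \<le> F q + L * dist p q" if "p \<in> S" "q \<in> S" for p q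
    using lipschitz_onD[OF L that] by (auto simp: dist_real_def)
  obtain a where a: "a \<in> S" using assms(2) by blast
  \<comment> \<open>The infimum is finite because the Lipschitz bound from one anchor point
    \<open>a\<close> bounds all its terms from below.\<close>
  have bdd: "bdd_below ((\<lambda>q. F q + L * dist p q) ` S)" for p
  proof (rule bdd_belowI2)
    fix q assume q: "q \<in> S"
    have "L * dist a q \<le> L * (dist p a + dist p q)"
      by (rule mult_left_mono[OF _ L0]) (metis dist_commute dist_triangle)
    then show "F a - L * dist p a \<le> F q + L * dist p q"
      using lip[OF a q] by (simp add: algebra_simps)
  qed
  have step: "G p \<le> G q + L * dist p q" for p q
  proof -
    have "G p - L * dist p q \<le> G q"
      unfolding G_def[of q]
    proof (rule cINF_greatest[OF assms(2)])
      fix s assume s: "s \<in> S"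
      have "G p \<le> F s + L * dist p s"
        unfolding G_def by (rule cINF_lower[OF bdd s])
      moreover have "L * dist p s \<le> L * (dist p q + dist q s)"
        by (rule mult_left_mono[OF dist_triangle L0])
      ultimately show "G p - L * dist p q \<le> F s + L * dist q s"
        by (simp add: algebra_simps)
    qed
    then show ?thesis by simp
  qed
  have "L-lipschitz_on UNIV G"
  proof (rule lipschitz_onI[OF _ L0])
    fix p q show "dist (G p) (G q) \<le> L * dist p q"
      using step[of p q] step[of q p] by (simp add: dist_real_def dist_commute abs_le_iff)
  qed
  moreover have "G x = F x" if "x \<in> S" for x
  proof (rule antisym)
    show "G x \<le> F x"
      unfolding G_def using cINF_lower[OF bdd that, of x] by simp
    show "F x \<le> G x"
      unfolding G_def by (rule cINF_greatest[OF assms(2)]) (rule lip[OF that])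
  qed
  ultimately show ?thesis by blast
qed

text \<open>The real-valued extension is applied to each coordinate. The constant grows by the
  dimension of the target, which is harmless: only some global constant is asked for.\<close>

lemma lipschitz_extension:
  fixes F :: "'a::metric_space \<Rightarrow> 'b::euclidean_space"
  assumes L: "L-lipschitz_on S F" and "S \<noteq> {}"
  obtains G M where "M-lipschitz_on UNIV G" and "\<And>x. x \<in> S \<Longrightarrow> G x = F x"
proof -
  have "\<exists>G. L-lipschitz_on UNIV G \<and> (\<forall>x\<in>S. G x = F x \<bullet> b)" if "b \<in> Basis" for b
  proof (rule lipschitz_extension_real[OF _ assms(2)])
    show "L-lipschitz_on S (\<lambda>x. F x \<bullet> b)"
    proof (rule lipschitz_onI[OF _ lipschitz_on_nonneg[OF L]])
      fix x y assume "x \<in> S" "y \<in> S"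
      have "\<bar>(F x - F y) \<bullet> b\<bar> \<le> norm (F x - F y)"
        using that by (rule Basis_le_norm)
      also have "\<dots> \<le> L * dist x y"
        using lipschitz_onD[OF L \<open>x \<in> S\<close> \<open>y \<in> S\<close>] by (simp add: dist_norm)
      finally show "dist (F x \<bullet> b) (F y \<bullet> b) \<le> L * dist x y"
        by (simp add: dist_real_def inner_diff_left)
    qed
  qed
  then obtain G where G: "\<And>b. b \<in> Basis \<Longrightarrow> L-lipschitz_on UNIV (G b)"
    "\<And>b x. b \<in> Basis \<Longrightarrow> x \<in> S \<Longrightarrow> G b x = F x \<bullet> b"
    by metis
  show thesis
  proof
    show "(\<Sum>b\<in>(Basis::'b set). L)-lipschitz_on UNIV (\<lambda>x. \<Sum>b\<in>Basis. G b x *\<^sub>R b)"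
    proof (rule lipschitz_onI)
      fix x y :: 'a
      have "dist (\<Sum>b\<in>Basis. G b x *\<^sub>R b) (\<Sum>b\<in>Basis. G b y *\<^sub>R b)
          = norm (\<Sum>b\<in>(Basis::'b set). (G b x - G b y) *\<^sub>R b)"
        by (simp add: dist_norm sum_subtractf scaleR_diff_left)
      also have "\<dots> \<le> (\<Sum>b\<in>(Basis::'b set). L * dist x y)"
      proof (rule sum_norm_le)
        fix b :: 'b assume b: "b \<in> Basis"
        show "norm ((G b x - G b y) *\<^sub>R b) \<le> L * dist x y"
          using lipschitz_onD[OF G(1)[OF b], of x y] b by (simp add: dist_real_def)
      qed
      finally show "dist (\<Sum>b\<in>Basis. G b x *\<^sub>R b) (\<Sum>b\<in>Basis. G b y *\<^sub>R b)
          \<le> (\<Sum>b\<in>(Basis::'b set). L) * dist x y"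
        by (simp add: sum_distrib_right)
    qed (simp add: lipschitz_on_nonneg[OF L])
    show "(\<Sum>b\<in>Basis. G b x *\<^sub>R b) = F x" if "x \<in> S" for x
      using that by (simp add: G(2) euclidean_representation)
  qed
qed

subsection \<open>Ordinary differential equations with a Lipschitz field\<close>

lemma integral_has_vector_derivative_atLeast:
  fixes \<phi> :: "real \<Rightarrow> 'a::banach"
  assumes "continuous_on UNIV \<phi>" and "t \<ge> 0"
  shows "((\<lambda>u. integral {0..u} \<phi>) has_vector_derivative \<phi> t) (at t within {0..})"
proof -
  \<comment> \<open>The fundamental theorem needs a bounded interval; any one reaching beyond
    \<open>t\<close> agrees with the half-line near \<open>t\<close>.\<close>
  have "((\<lambda>u. integral {0..u} \<phi>) has_vector_derivative \<phi> t) (at t within {0..t+1})"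
    by (rule integral_has_vector_derivative)
      (use assms continuous_on_subset in auto)
  moreover have "at t within {0..t+1} = at t within {0..}"
    by (rule at_within_nhd[of t "{..<t+1}"]) auto
  ultimately show ?thesis by simp
qed

text \<open>Integrating \<open>exp (k * s)\<close> gains a factor \<open>1 / k\<close>, and the
  weight \<open>exp (- (k * t))\<close> cancels the remaining growth. This factor makes the Picard
  operator a contraction.\<close>

lemma norm_integral_exp_bound:
  fixes \<phi> :: "real \<Rightarrow> 'a::banach"
  assumes "continuous_on UNIV \<phi>" and "t \<ge> 0" and "k > 0" and "B \<ge> 0"
    and bound: "\<And>s. s \<ge> 0 \<Longrightarrow> norm (\<phi> s) \<le> B * exp (k * s)"
  shows "norm (exp (- (k * t)) *\<^sub>R integral {0..t} \<phi>) \<le> B / k"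
proof -
  have I: "((\<lambda>s. B * exp (k * s)) has_integral (B / k * exp (k * t) - B / k * exp (k * 0))) {0..t}"
    by (rule fundamental_theorem_of_calculus[OF assms(2)])
      (use \<open>k > 0\<close> in \<open>auto intro!: derivative_eq_intros simp: has_real_derivative_iff_has_vector_derivative[symmetric]\<close>)
  have "norm (integral {0..t} \<phi>) \<le> integral {0..t} (\<lambda>s. B * exp (k * s))"
    by (rule integral_norm_bound_integral)
      (use bound I in \<open>auto intro!: integrable_continuous_real continuous_on_subset[OF assms(1)]
        simp: has_integral_integrable\<close>)
  also have "\<dots> = B / k * exp (k * t) - B / k"
    using integral_unique[OF I] by simp
  also have "\<dots> \<le> B / k * exp (k * t)"
    using assms by simp
  finally have "exp (- (k * t)) * norm (integral {0..t} \<phi>) \<le> exp (- (k * t)) * (B / k * exp (k * t))"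
    by (intro mult_left_mono) auto
  then show ?thesis
    by (simp add: exp_minus field_simps)
qed

lemma lipschitz_ode_solution_exists:
  fixes F :: "'a::banach \<Rightarrow> 'a"
  assumes L: "L-lipschitz_on UNIV F"
  obtains x where "ode_solution F {0..} x" and "x 0 = p"
proof -
  have L0: "L \<ge> 0" using L by (rule lipschitz_on_nonneg)
  \<comment> \<open>The unknown is \<open>u t = exp (- k t) (x t - p)\<close>: with this weight the Picard operator is a contraction
    on the bounded continuous functions, and the solution is global at once. Negative times are
    clamped to \<open>0\<close>.\<close>
  define k where "k = 2 * L + 1"
  \<comment> \<open>\<open>L / k\<close> will be the contraction factor; the summand 1 in
    \<open>k\<close> keeps it defined when \<open>L = 0\<close>.\<close>
  have k: "k > 0" "L / k < 1" "L / k \<ge> 0" using L0 by (auto simp: k_def)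
  \<comment> \<open>\<open>\<phi> u\<close> is the field along the curve that \<open>u\<close>
    encodes, and \<open>H u\<close> is the Picard integral of that field written in the weighted
    unknown.\<close>
  define \<phi> where "\<phi> u s = F (p + exp (k * s) *\<^sub>R apply_bcontfun u s)" for u :: "real \<Rightarrow>\<^sub>C 'a" and s
  define H where "H u t = exp (- (k * t)) *\<^sub>R integral {0..t} (\<phi> u)" for u t
  have contF: "continuous_on UNIV F" using L by (rule lipschitz_on_continuous_on)
  have cont\<phi>: "continuous_on UNIV (\<phi> u)" for u
    unfolding \<phi>_def
    by (rule continuous_on_compose2[OF contF]) (auto intro!: continuous_intros)
  have contI: "continuous_on {0..} (\<lambda>t. integral {0..t} (\<phi> u))" for u
    unfolding continuous_on_eq_continuous_within
    using integral_has_vector_derivative_atLeast[OF cont\<phi>] has_vector_derivative_continuous by fastforce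
  have contH: "continuous_on UNIV (\<lambda>t. H u (max 0 t))" for u
  proof (rule continuous_on_compose2[of "{0..}" "H u"])
    show "continuous_on {0..} (H u)"
      unfolding H_def by (intro continuous_intros contI)
  qed (auto intro!: continuous_intros)
  \<comment> \<open>Comparing \<open>F\<close> with its value at \<open>p\<close> gives growth of
    order \<open>exp (k * s)\<close> at most, so the operator stays within the bounded
    functions.\<close>
  have boundH: "norm (H u (max 0 t)) \<le> (norm (F p) + L * norm u) / k" for u t
    unfolding H_def
  proof (rule norm_integral_exp_bound[OF cont\<phi> _ k(1)])
    fix s :: real assume s: "s \<ge> 0"
    have "norm (\<phi> u s - F p) \<le> L * norm (exp (k * s) *\<^sub>R apply_bcontfun u s)"
      using lipschitz_onD[OF L, of "p + exp (k * s) *\<^sub>R apply_bcontfun u s" p]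
      by (simp add: \<phi>_def dist_norm)
    also have "\<dots> \<le> L * (exp (k * s) * norm u)"
      by (intro mult_left_mono L0) (simp add: norm_bounded)
    finally have "norm (\<phi> u s - F p) \<le> L * norm u * exp (k * s)" by (simp add: algebra_simps)
    moreover have "norm (F p) * 1 \<le> norm (F p) * exp (k * s)"
      using s k by (intro mult_left_mono) auto
    ultimately show "norm (\<phi> u s) \<le> (norm (F p) + L * norm u) * exp (k * s)"
      using norm_triangle_sub[of "\<phi> u s" "F p"] by (simp add: algebra_simps)
  qed (use L0 in auto)
  define P where "P u = Bcontfun (\<lambda>t. H u (max 0 t))" for u
  have P: "apply_bcontfun (P u) t = H u (max 0 t)" for u t
  proof -
    have "(\<lambda>t. H u (max 0 t)) \<in> bcontfun"
      unfolding bcontfun_def using contH boundH by (auto simp: bounded_iff)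
    then show ?thesis by (simp add: P_def Bcontfun_inverse)
  qed
  have "\<exists>!u. P u = u"
  proof (rule banach_fix_type[OF k(3) k(2)], intro allI, rule dist_bound)
    fix u u' :: "real \<Rightarrow>\<^sub>C 'a" and t
    have "dist (P u t) (P u' t)
        = norm (exp (- (k * max 0 t)) *\<^sub>R integral {0..max 0 t} (\<lambda>s. \<phi> u s - \<phi> u' s))"
      unfolding P H_def dist_norm
      by (subst integral_diff)
        (auto simp: scaleR_diff_right intro!: integrable_continuous_real continuous_on_subset[OF cont\<phi>])
    also have "\<dots> \<le> (L * dist u u') / k"
    proof (rule norm_integral_exp_bound[OF _ _ k(1)])
      show "continuous_on UNIV (\<lambda>s. \<phi> u s - \<phi> u' s)"
        by (intro continuous_intros cont\<phi>)
      fix s :: real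
      have "norm (\<phi> u s - \<phi> u' s) \<le> L * norm (exp (k * s) *\<^sub>R (u s - u' s))"
        using lipschitz_onD[OF L, of "p + exp (k * s) *\<^sub>R apply_bcontfun u s" "p + exp (k * s) *\<^sub>R apply_bcontfun u' s"]
        by (simp add: \<phi>_def dist_norm scaleR_diff_right)
      also have "\<dots> \<le> L * (exp (k * s) * dist u u')"
        using dist_bounded[of u s u'] by (intro mult_left_mono L0) (simp add: dist_norm)
      finally show "norm (\<phi> u s - \<phi> u' s) \<le> L * dist u u' * exp (k * s)"
        by (simp add: algebra_simps)
    qed (use L0 in auto)
    finally show "dist (P u t) (P u' t) \<le> L / k * dist u u'" by simp
  qed
  then obtain u where u: "P u = u" by blast
  \<comment> \<open>The fixed point with the weight removed: the left side is the argument of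
    \<open>F\<close> inside \<open>\<phi>\<close>, the right side is what can be
    differentiated.\<close>
  have eq: "p + exp (k * t) *\<^sub>R apply_bcontfun u t = p + integral {0..t} (\<phi> u)" if "t \<ge> 0" for t
    using P[of u t] that by (simp add: u H_def flip: exp_add)
  show thesis
  proof
    show "ode_solution F {0..} (\<lambda>t. p + integral {0..t} (\<phi> u))"
      unfolding ode_solution_def
    proof
      fix t :: real assume "t \<in> {0..}"
      then have t: "t \<ge> 0" by simp
      have "((\<lambda>t. p + integral {0..t} (\<phi> u)) has_vector_derivative \<phi> u t) (at t within {0..})"
        using has_vector_derivative_add[OF has_vector_derivative_const
            integral_has_vector_derivative_atLeast[OF cont\<phi> t]] by simp
      then show "((\<lambda>t. p + integral {0..t} (\<phi> u)) has_vector_derivative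
          F (p + integral {0..t} (\<phi> u))) (at t within {0..})"
        by (simp add: \<phi>_def[of u t] eq[OF t])
    qed
  qed simp
qed

section \<open>Gronwall's inequality, uniqueness and invariance\<close>

text \<open>The hypothesis bounds forward increments instead of a derivative, since norms and
  distances along a solution need not be differentiable. If \<open>d T\<close> were positive,
  \<open>d\<close> would have to leave the region below an exponential barrier of rate
  \<open>L + 1\<close>; at the last time in that region the step bound keeps it there a little
  longer.\<close>

lemma gronwall_dini:
  fixes d :: "real \<Rightarrow> real"
  assumes cont: "continuous_on {0..T} d" and T: "T \<ge> 0" and "d 0 \<le> 0" and L: "L \<ge> 0"
    and step: "\<And>t \<epsilon>. 0 \<le> t \<Longrightarrow> t < T \<Longrightarrow> \<epsilon> > 0 \<Longrightarrow>
      \<forall>\<^sub>F h in at_right 0. d (t + h) \<le> d t + h * (L * d t + \<epsilon>)"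
  shows "d T \<le> 0"
proof (rule ccontr)
  assume "\<not> d T \<le> 0"
  \<comment> \<open>Scaled so that the barrier \<open>\<psi>\<close> ends at half of
    \<open>d T\<close>, while starting above \<open>d 0\<close>.\<close>
  define k where "k = d T / (2 * exp ((L + 1) * T))"
  define \<psi> where "\<psi> t = k * exp ((L + 1) * t)" for t
  have k: "k > 0" using \<open>\<not> d T \<le> 0\<close> by (simp add: k_def)
  have \<psi>T: "\<psi> T < d T" using \<open>\<not> d T \<le> 0\<close> by (simp add: \<psi>_def k_def)
  define S where "S = {t \<in> {0..T}. d t - \<psi> t \<le> 0}"
  have "continuous_on {0..T} (\<lambda>t. d t - \<psi> t)"
    unfolding \<psi>_def by (intro continuous_intros cont)
  then have "closed S"
    unfolding S_def by (intro continuous_on_closed_Collect_le) auto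
  then have "compact S"
    unfolding compact_eq_bounded_closed S_def by (auto intro: bounded_subset[of "{0..T}"])
  moreover have "0 \<in> S" using T \<open>d 0 \<le> 0\<close> k by (simp add: S_def \<psi>_def)
  ultimately obtain s where s: "s \<in> S" "\<And>t. t \<in> S \<Longrightarrow> t \<le> s"
    using compact_attains_sup[of S] by blast
  have "s < T" using s(1) \<psi>T by (force simp: S_def less_le)
  have s0: "0 \<le> s" "d s \<le> \<psi> s" using s(1) by (auto simp: S_def)
  have "\<psi> s > 0" using k by (simp add: \<psi>_def)
  \<comment> \<open>The error is chosen as \<open>\<psi> s\<close>: it is exactly absorbed by the
    surplus of the rate \<open>L + 1\<close> over \<open>L\<close>.\<close>
  have "\<forall>\<^sub>F h in at_right 0. h > 0 \<and> s + h \<le> T \<and> d (s + h) \<le> d s + h * (L * d s + \<psi> s)"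
    using step[OF s0(1) \<open>s < T\<close> \<open>\<psi> s > 0\<close>] \<open>s < T\<close>
    by (intro eventually_conj eventually_at_right_less) (auto intro: eventually_at_rightI[of 0 "T - s"])
  then obtain h where h: "h > 0" "s + h \<le> T" "d (s + h) \<le> d s + h * (L * d s + \<psi> s)"
    using eventually_happens[of _ "at_right (0::real)"] by auto
  have "d s * (1 + h * L) \<le> \<psi> s * (1 + h * L)"
    using s0(2) h(1) L by (intro mult_right_mono) auto
  then have "d (s + h) \<le> \<psi> s * (1 + (L + 1) * h)"
    using h(3) by (simp add: algebra_simps)
  also have "\<dots> \<le> \<psi> s * exp ((L + 1) * h)"
    using \<open>\<psi> s > 0\<close> by (intro mult_left_mono exp_ge_add_one_self) auto
  also have "\<dots> = \<psi> (s + h)"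
    by (simp add: \<psi>_def exp_add algebra_simps)
  finally have "s + h \<in> S" using h s0 by (simp add: S_def)
  then show False using s(2) h(1) by fastforce
qed

text \<open>Differentiability in the form that the step hypothesis of \<open>gronwall_dini\<close>
  consumes.\<close>

lemma has_vector_derivative_forward:
  fixes x :: "real \<Rightarrow> 'a::real_normed_vector"
  assumes "(x has_vector_derivative x') (at t within {0..T})" and "0 \<le> t" "t < T" and "\<epsilon> > 0"
  shows "\<forall>\<^sub>F h in at_right 0. norm (x (t + h) - (x t + h *\<^sub>R x')) \<le> h * \<epsilon>"
proof -
  obtain d where d: "d > 0" and
    D: "\<And>s. s \<in> {0..T} \<Longrightarrow> norm (s - t) < d \<Longrightarrow>
      norm (x s - x t - (s - t) *\<^sub>R x') \<le> \<epsilon> * norm (s - t)"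
    using assms(1,4) unfolding has_vector_derivative_def has_derivative_within_alt by blast
  show ?thesis
  proof (rule eventually_at_rightI[of 0 "min d (T - t)"])
    fix h assume "h \<in> {0<..<min d (T - t)}"
    then show "norm (x (t + h) - (x t + h *\<^sub>R x')) \<le> h * \<epsilon>"
      using D[of "t + h"] assms(2) by (simp add: algebra_simps)
  qed (use d assms in auto)
qed

lemma ode_solution_continuous_on:
  "ode_solution F I x \<Longrightarrow> continuous_on I x"
  unfolding ode_solution_def continuous_on_eq_continuous_within
  by (blast intro: has_vector_derivative_continuous)

lemma ode_solution_subset:
  "ode_solution F I x \<Longrightarrow> J \<subseteq> I \<Longrightarrow> ode_solution F J x"
  unfolding ode_solution_def by (blast intro: has_vector_derivative_within_subset)

text \<open>The distance between the two solutions satisfies the hypothesis of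
  \<open>gronwall_dini\<close>. The Lipschitz bound is asked on \<open>C\<close> alone, so the
  result applies to a policy that is meaningful only on the safe set.\<close>

lemma lipschitz_ode_solution_unique:
  fixes F :: "'a::real_normed_vector \<Rightarrow> 'a"
  assumes L: "L-lipschitz_on C F" and T: "T \<ge> 0"
    and x: "ode_solution F {0..T} x" "\<And>t. t \<in> {0..T} \<Longrightarrow> x t \<in> C"
    and y: "ode_solution F {0..T} y" "\<And>t. t \<in> {0..T} \<Longrightarrow> y t \<in> C"
    and "x 0 = y 0"
  shows "x T = y T"
proof -
  have "norm (x T - y T) \<le> 0"
  proof (rule gronwall_dini[where d = "\<lambda>t. norm (x t - y t)" and L = L])
    show "continuous_on {0..T} (\<lambda>t. norm (x t - y t))"
      using x(1) y(1) by (intro continuous_intros ode_solution_continuous_on)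
    fix t \<epsilon> :: real assume t: "0 \<le> t" "t < T" and \<epsilon>: "\<epsilon> > 0"
    have "((\<lambda>s. x s - y s) has_vector_derivative F (x t) - F (y t)) (at t within {0..T})"
      using x(1) y(1) t unfolding ode_solution_def by (intro has_vector_derivative_diff) auto
    from has_vector_derivative_forward[OF this t \<epsilon>] eventually_at_right_less[of 0]
    show "\<forall>\<^sub>F h in at_right 0. norm (x (t + h) - y (t + h))
        \<le> norm (x t - y t) + h * (L * norm (x t - y t) + \<epsilon>)"
    proof eventually_elim
      case (elim h)
      have "norm (F (x t) - F (y t)) \<le> L * norm (x t - y t)"
        using lipschitz_onD[OF L x(2) y(2), of t t] t by (simp add: dist_norm)
      then have "h * norm (F (x t) - F (y t)) \<le> h * (L * norm (x t - y t))"
        using elim(2) by (intro mult_left_mono) auto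
      moreover have "norm (x (t + h) - y (t + h)) \<le> norm (x t - y t)
          + norm (h *\<^sub>R (F (x t) - F (y t))) + h * \<epsilon>"
        using elim(1) norm_triangle_sub[of "x (t + h) - y (t + h)" "x t - y t + h *\<^sub>R (F (x t) - F (y t))"]
          norm_triangle_ineq[of "x t - y t" "h *\<^sub>R (F (x t) - F (y t))"] by linarith
      ultimately show ?case using elim(2)
        unfolding distrib_left norm_scaleR by linarith
    qed
  qed (use assms lipschitz_on_nonneg[OF L] in auto)
  then show ?thesis by simp
qed

text \<open>Near a solution point \<open>x t\<close>, the motion is compared with that of its
  nearest point \<open>q\<close> in \<open>C\<close>. The two velocities differ by at most
  \<open>L\<close> times the distance, and \<open>q\<close> itself moves along \<open>C\<close> up
  to a small error, so \<open>gronwall_dini\<close> applies to the distance from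
  \<open>C\<close>.\<close>

lemma nagumo_invariance:
  fixes F :: "'a::euclidean_space \<Rightarrow> 'a"
  assumes "closed C" and L: "L-lipschitz_on UNIV F"
    and subtangent: "\<And>q \<epsilon>. q \<in> C \<Longrightarrow> \<epsilon> > 0 \<Longrightarrow>
      \<forall>\<^sub>F h in at_right 0. infdist (q + h *\<^sub>R F q) C \<le> h * \<epsilon>"
    and x: "ode_solution F {0..} x" and "x 0 \<in> C" and "T \<ge> 0"
  shows "x T \<in> C"
proof -
  have "C \<noteq> {}" using \<open>x 0 \<in> C\<close> by blast
  have xT: "ode_solution F {0..T} x" using x by (rule ode_solution_subset) auto
  have "infdist (x T) C \<le> 0"
  proof (rule gronwall_dini[where d = "\<lambda>t. infdist (x t) C" and L = L])
    show "continuous_on {0..T} (\<lambda>t. infdist (x t) C)"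
      using xT by (intro continuous_intros ode_solution_continuous_on)
    fix t \<epsilon> :: real assume t: "0 \<le> t" "t < T" and \<epsilon>: "\<epsilon> > 0"
    obtain q where q: "q \<in> C" "infdist (x t) C = dist (x t) q"
      using infdist_attains_inf[OF \<open>closed C\<close> \<open>C \<noteq> {}\<close>] by metis
    have "(x has_vector_derivative F (x t)) (at t within {0..T})"
      using xT t unfolding ode_solution_def by auto
    \<comment> \<open>Half of \<epsilon> pays for linearizing the solution at \<open>x t\<close>,
      the other half for the subtangency error at \<open>q\<close>.\<close>
    from has_vector_derivative_forward[OF this t half_gt_zero[OF \<epsilon>]]
      subtangent[OF q(1) half_gt_zero[OF \<epsilon>]] eventually_at_right_less[of 0]
    show "\<forall>\<^sub>F h in at_right 0. infdist (x (t + h)) C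
        \<le> infdist (x t) C + h * (L * infdist (x t) C + \<epsilon>)"
    proof eventually_elim
      case (elim h)
      have "dist (F (x t)) (F q) \<le> L * dist (x t) q"
        by (rule lipschitz_onD[OF L]) auto
      then have "h * norm (F (x t) - F q) \<le> h * (L * dist (x t) q)"
        using elim(3) by (intro mult_left_mono) (auto simp: dist_norm)
      moreover have "dist (x (t + h)) (q + h *\<^sub>R F q)
          \<le> dist (x (t + h)) (x t + h *\<^sub>R F (x t)) + dist (x t + h *\<^sub>R F (x t)) (q + h *\<^sub>R F q)"
        by (rule dist_triangle)
      moreover have "dist (x t + h *\<^sub>R F (x t)) (q + h *\<^sub>R F q)
          \<le> dist (x t) q + h * norm (F (x t) - F q)"
      proof -
        have "x t + h *\<^sub>R F (x t) - (q + h *\<^sub>R F q) = (x t - q) + h *\<^sub>R (F (x t) - F q)"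
          by (simp add: algebra_simps)
        then have "dist (x t + h *\<^sub>R F (x t)) (q + h *\<^sub>R F q)
            = norm ((x t - q) + h *\<^sub>R (F (x t) - F q))"
          by (simp only: dist_norm)
        also have "\<dots> \<le> norm (x t - q) + norm (h *\<^sub>R (F (x t) - F q))"
          by (rule norm_triangle_ineq)
        finally show ?thesis using elim(3) by (simp only: dist_norm norm_scaleR abs_of_pos)
      qed
      moreover have "infdist (x (t + h)) C
          \<le> infdist (q + h *\<^sub>R F q) C + dist (x (t + h)) (q + h *\<^sub>R F q)"
        by (rule infdist_triangle)
      moreover have "h * (\<epsilon> / 2) + h * (\<epsilon> / 2) = h * \<epsilon>" by simp
      ultimately show ?case
        using elim(1,2) unfolding q(2) distrib_left dist_norm by linarith
    qed
  qed (use assms lipschitz_on_nonneg[OF L] in auto)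
  then have "infdist (x T) C = 0" using infdist_nonneg[of "x T" C] by linarith
  then show ?thesis using in_closed_iff_infdist_zero[OF \<open>closed C\<close> \<open>C \<noteq> {}\<close>] by blast
qed

subsection \<open>Class K majorants\<close>

text \<open>Points with \<open>b\<close> below \<epsilon> need no slope. The others form a compact
  set that avoids \<open>a = 0\<close>, so \<open>a\<close> has a positive minimum there; the
  largest \<open>b\<close> divided by the smallest \<open>a\<close> is a sufficient slope.\<close>

lemma affine_majorant:
  fixes K :: "(real \<times> real) set"
  assumes "compact K" and nonneg: "\<And>a b. (a, b) \<in> K \<Longrightarrow> a \<ge> 0"
    and zero: "\<And>b. (0, b) \<in> K \<Longrightarrow> b \<le> 0" and "\<epsilon> > 0"
  shows "\<exists>M\<ge>0. \<forall>(a, b)\<in>K. b \<le> \<epsilon> + M * a"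
proof -
  define K' where "K' = K \<inter> {p. snd p \<ge> \<epsilon>}"
  have "compact K'"
    unfolding K'_def using assms(1)
    by (intro compact_Int_closed closed_Collect_le continuous_intros) auto
  show ?thesis
  proof (cases "K' = {}")
    case True
    then show ?thesis by (intro exI[of _ 0]) (force simp: K'_def)
  next
    case False
    obtain p where p: "p \<in> K'" "\<And>q. q \<in> K' \<Longrightarrow> fst p \<le> fst q"
      using continuous_attains_inf[OF \<open>compact K'\<close> False continuous_on_fst[OF continuous_on_id]] by blast
    obtain q where q: "q \<in> K'" "\<And>p. p \<in> K' \<Longrightarrow> snd p \<le> snd q"
      using continuous_attains_sup[OF \<open>compact K'\<close> False continuous_on_snd[OF continuous_on_id]] by blast
    have "fst p > 0"
      using p(1) nonneg[of "fst p" "snd p"] zero[of "snd p"] \<open>\<epsilon> > 0\<close>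
      by (cases p) (auto simp: K'_def less_le)
    have "snd q > 0" using q(1) \<open>\<epsilon> > 0\<close> by (simp add: K'_def)
    show ?thesis
    proof (rule exI[of _ "snd q / fst p"], safe)
      fix a b assume ab: "(a, b) \<in> K"
      have a: "a \<ge> 0" using nonneg[OF ab] .
      show "b \<le> \<epsilon> + snd q / fst p * a"
      proof (cases "b \<ge> \<epsilon>")
        case True
        then have "(a, b) \<in> K'" using ab by (simp add: K'_def)
        then have "b \<le> snd q" "fst p \<le> a" using p(2)[of "(a, b)"] q(2)[of "(a, b)"] by auto
        then have "b \<le> snd q / fst p * a"
        proof -
          have "b * fst p \<le> snd q * a"
            using \<open>b \<le> snd q\<close> \<open>fst p \<le> a\<close>
            by (rule mult_mono) (use \<open>fst p > 0\<close> \<open>snd q > 0\<close> in auto)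
          then show ?thesis using \<open>fst p > 0\<close> by (simp add: pos_le_divide_eq)
        qed
        then show ?thesis using \<open>\<epsilon> > 0\<close> by simp
      next
        case False
        moreover have "snd q / fst p * a \<ge> 0" using a \<open>fst p > 0\<close> \<open>snd q > 0\<close> by simp
        ultimately show ?thesis by linarith
      qed
    qed (use \<open>fst p > 0\<close> \<open>snd q > 0\<close> in simp)
  qed
qed

text \<open>Take the infimum \<open>A\<close> of the affine majorants over all \<epsilon>. It
  vanishes at 0 because the intercepts \<epsilon> tend to 0, and it still lies above
  \<open>K\<close>. Adding the identity makes it strictly increasing.\<close>

lemma class_K_majorant:
  fixes K :: "(real \<times> real) set"
  assumes "compact K" and nonneg: "\<And>a b. (a, b) \<in> K \<Longrightarrow> a \<ge> 0"
    and zero: "\<And>b. (0, b) \<in> K \<Longrightarrow> b \<le> 0"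
  obtains \<alpha> where "class_K \<alpha>" and "\<And>a b. (a, b) \<in> K \<Longrightarrow> b \<le> \<alpha> a"
proof -
  define M where "M \<epsilon> = (SOME m. m \<ge> 0 \<and> (\<forall>(a, b)\<in>K. b \<le> \<epsilon> + m * a))" for \<epsilon>
  have "M \<epsilon> \<ge> 0 \<and> (\<forall>(a, b)\<in>K. b \<le> \<epsilon> + M \<epsilon> * a)" if "\<epsilon> > 0" for \<epsilon>
    unfolding M_def by (rule someI_ex) (rule affine_majorant[OF assms that])
  then have M: "\<And>\<epsilon>. \<epsilon> > 0 \<Longrightarrow> M \<epsilon> \<ge> 0"
    "\<And>\<epsilon> a b. \<epsilon> > 0 \<Longrightarrow> (a, b) \<in> K \<Longrightarrow> b \<le> \<epsilon> + M \<epsilon> * a"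
    by auto
  \<comment> \<open>An infimum of affine functions is concave, hence continuous on the open half-line.\<close>
  define A where "A s = (INF \<epsilon>\<in>{0<..}. \<epsilon> + M \<epsilon> * s)" for s
  have ne: "{0::real<..} \<noteq> {}" by auto
  have bdd: "bdd_below ((\<lambda>\<epsilon>. \<epsilon> + M \<epsilon> * s) ` {0<..})" if "s \<ge> 0" for s
    by (rule bdd_belowI2[of _ 0]) (use that M(1) in auto)
  have upper: "A s \<le> \<epsilon> + M \<epsilon> * s" if "s \<ge> 0" "\<epsilon> > 0" for s \<epsilon>
    unfolding A_def by (rule cINF_lower[OF bdd]) (use that in auto)
  have lower: "c \<le> A s" if "\<And>\<epsilon>. \<epsilon> > 0 \<Longrightarrow> c \<le> \<epsilon> + M \<epsilon> * s" for c s
    unfolding A_def by (rule cINF_greatest[OF ne]) (use that in auto)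
  have A0: "A 0 = 0"
  proof (rule antisym)
    show "A 0 \<le> 0" by (rule field_le_epsilon) (use upper[of 0] in simp)
  qed (rule lower, simp)
  have Apos: "A s \<ge> 0" if "s \<ge> 0" for s
    by (rule lower) (use that M(1) in simp)
  have mono: "A s \<le> A t" if "0 \<le> s" "s \<le> t" for s t
  proof (rule lower)
    fix \<epsilon> :: real assume "\<epsilon> > 0"
    then show "A s \<le> \<epsilon> + M \<epsilon> * t"
      using upper[OF that(1) \<open>\<epsilon> > 0\<close>] mult_left_mono[OF that(2) M(1)[OF \<open>\<epsilon> > 0\<close>]] by linarith
  qed
  have "convex_on {0<..} (\<lambda>s. - A s)"
  proof (rule convex_onI)
    fix t x y :: real assume t: "0 < t" "t < 1" and xy: "x \<in> {0<..}" "y \<in> {0<..}"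
    have "(1 - t) * A x + t * A y \<le> A ((1 - t) * x + t * y)"
    proof (rule lower)
      fix \<epsilon> :: real assume \<epsilon>: "\<epsilon> > 0"
      have "(1 - t) * A x + t * A y \<le> (1 - t) * (\<epsilon> + M \<epsilon> * x) + t * (\<epsilon> + M \<epsilon> * y)"
        using upper[OF _ \<epsilon>, of x] upper[OF _ \<epsilon>, of y] t xy
        by (intro add_mono mult_left_mono) auto
      then show "(1 - t) * A x + t * A y \<le> \<epsilon> + M \<epsilon> * ((1 - t) * x + t * y)"
        by (simp add: algebra_simps)
    qed
    then show "- A ((1 - t) *\<^sub>R x + t *\<^sub>R y) \<le> (1 - t) * - A x + t * - A y" by simp
  qed auto
  then have "continuous_on {0<..} (\<lambda>s. - (- A s))"
    by (intro continuous_on_minus convex_on_continuous) auto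
  then have cont_pos: "isCont A s" if "s > 0" for s
    using that by (simp add: continuous_on_eq_continuous_at)
  \<comment> \<open>Concavity settles only the open half-line. At 0, \<open>A\<close> is squeezed
    between 0 and the single affine majorant with intercept \<open>e / 2\<close>.\<close>
  have cont0: "(A \<longlongrightarrow> A 0) (at 0 within {0..})"
    unfolding A0
  proof (rule tendstoI)
    fix e :: real assume e: "e > 0"
    \<comment> \<open>Within this radius the linear term stays below \<open>e / 2\<close>; the 1
      keeps the denominator positive.\<close>
    define d where "d = e / 2 / (M (e / 2) + 1)"
    have M0: "M (e / 2) \<ge> 0" using M(1) e by simp
    have d: "d > 0" using M0 e by (simp add: d_def)
    show "\<forall>\<^sub>F s in at 0 within {0..}. dist (A s) 0 < e"
      unfolding eventually_at
    proof (intro exI[of _ d] conjI d ballI impI)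
      fix s :: real assume s: "s \<in> {0..}" "s \<noteq> 0 \<and> dist s 0 < d"
      have "M (e / 2) * s \<le> (M (e / 2) + 1) * s" using s by (simp add: algebra_simps)
      also have "\<dots> < (M (e / 2) + 1) * d" using s M0 by (intro mult_strict_left_mono) auto
      also have "\<dots> = e / 2"
      proof -
        have "M (e / 2) + 1 \<noteq> 0" using M0 by linarith
        then show ?thesis unfolding d_def
          by (subst times_divide_eq_right) (rule nonzero_mult_div_cancel_left)
      qed
      finally show "dist (A s) 0 < e" using upper[of s "e / 2"] Apos[of s] s e by simp
    qed
  qed
  have "continuous_on {0..} A"
    unfolding continuous_on_def
  proof
    fix s :: real assume "s \<in> {0..}"
    then show "(A \<longlongrightarrow> A s) (at s within {0..})"
      using cont0 cont_pos[of s] by (cases "s = 0") (auto simp: isCont_def intro: tendsto_within_subset)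
  qed
  then have "class_K (\<lambda>s. s + A s)"
    unfolding class_K_def
    by (intro conjI continuous_intros strict_mono_onI add_less_le_mono mono) (simp_all add: A0)
  moreover have "b \<le> a + A a" if "(a, b) \<in> K" for a b
  proof -
    have "b \<le> A a" by (rule lower) (rule M(2)[OF _ that])
    then show ?thesis using nonneg[OF that] by simp
  qed
  ultimately show thesis using that by blast
qed


subsection \<open>Safety margins and the closed loop\<close>

text \<open>Active components increase to first order along \<open>z\<close>, inactive ones stay
  positive by continuity, and there are only finitely many of them.\<close>

lemma inward_direction_feasible:
  fixes \<Delta> :: "'a::real_normed_vector \<Rightarrow> real^'c"
  assumes "open A" and "p \<in> A" and \<Delta>': "(\<Delta> has_derivative \<Delta>') (at p)"
    and "\<And>i. \<Delta> p $ i \<ge> 0" and active: "\<And>i. \<Delta> p $ i = 0 \<Longrightarrow> \<Delta>' z $ i > 0"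
  shows "\<forall>\<^sub>F h in at_right 0. p + h *\<^sub>R z \<in> A \<and> (\<forall>i. \<Delta> (p + h *\<^sub>R z) $ i \<ge> 0)"
proof (rule eventually_conj)
  have "((\<lambda>h. p + h *\<^sub>R z) \<longlongrightarrow> p + 0 *\<^sub>R z) (at_right 0)"
    by (intro tendsto_intros)
  then have lim: "((\<lambda>h. p + h *\<^sub>R z) \<longlongrightarrow> p) (at_right 0)" by simp
  show "\<forall>\<^sub>F h in at_right 0. p + h *\<^sub>R z \<in> A"
    using lim assms(1,2) by (rule topological_tendstoD)
  show "\<forall>\<^sub>F h in at_right 0. \<forall>i. \<Delta> (p + h *\<^sub>R z) $ i \<ge> 0"
  proof (rule eventually_all_finite)
    fix i
    show "\<forall>\<^sub>F h in at_right 0. \<Delta> (p + h *\<^sub>R z) $ i \<ge> 0"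
    proof (cases "\<Delta> p $ i = 0")
      case True
      have "((\<lambda>h. p + h *\<^sub>R z) has_derivative (\<lambda>h. h *\<^sub>R z)) (at 0)"
        by (auto intro!: derivative_eq_intros)
      from has_derivative_compose[OF this, of \<Delta> \<Delta>'] \<Delta>'
      have "((\<lambda>h. \<Delta> (p + h *\<^sub>R z) $ i) has_derivative (\<lambda>h. \<Delta>' (h *\<^sub>R z) $ i)) (at 0)"
        by (auto intro: bounded_linear.has_derivative[OF bounded_linear_vec_nth])
      then have "DERIV (\<lambda>h. \<Delta> (p + h *\<^sub>R z) $ i) 0 :> \<Delta>' z $ i"
        using linear_scale[OF has_derivative_linear[OF \<Delta>']]
        by (simp add: has_field_derivative_def mult_commute_abs)
      from DERIV_pos_inc_right[OF this active[OF True]] obtain d where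
        "d > 0" "\<And>h. h > 0 \<Longrightarrow> h < d \<Longrightarrow> \<Delta> p $ i < \<Delta> (p + h *\<^sub>R z) $ i"
        by auto
      then show ?thesis
        using True by (intro eventually_at_rightI[of 0 d]) (auto simp: less_imp_le)
    next
      case False
      then have "\<Delta> p $ i > 0" using assms(4)[of i] by simp
      moreover have "((\<lambda>h. \<Delta> (p + h *\<^sub>R z) $ i) \<longlongrightarrow> \<Delta> p $ i) (at_right 0)"
        using has_derivative_continuous[OF \<Delta>'] lim
        by (intro tendsto_vec_nth isCont_tendsto_compose[of p \<Delta>])
      ultimately have "\<forall>\<^sub>F h in at_right 0. 0 < \<Delta> (p + h *\<^sub>R z) $ i" by (rule order_tendstoD(1)[rotated])
      then show ?thesis by eventually_elim simp
    qed
  qed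
qed

text \<open>A direction that is merely nonnegative on the active components may leave the set at
  second order. Tilting it by a small multiple of the strictly inward \<open>z\<close> gives a
  feasible direction, at a distance controlled by \<epsilon>.\<close>

lemma subtangent_if_inward:
  fixes \<Delta> :: "'a::real_normed_vector \<Rightarrow> real^'c"
  assumes "open A" and "p \<in> A" and \<Delta>': "(\<Delta> has_derivative \<Delta>') (at p)"
    and "\<And>i. \<Delta> p $ i \<ge> 0" and y: "\<And>i. \<Delta> p $ i = 0 \<Longrightarrow> \<Delta>' y $ i \<ge> 0"
    and z: "\<And>i. \<Delta> p $ i = 0 \<Longrightarrow> \<Delta>' z $ i > 0" and \<epsilon>: "\<epsilon> > 0"
  shows "\<forall>\<^sub>F h in at_right 0. infdist (p + h *\<^sub>R y) {q \<in> A. \<forall>i. \<Delta> q $ i \<ge> 0} \<le> h * \<epsilon>"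
proof -
  \<comment> \<open>The tilt moves the velocity by at most \<epsilon>; the 1 covers
    \<open>z = 0\<close>, which is possible when no component is active.\<close>
  define c where "c = \<epsilon> / (norm z + 1)"
  have c: "c > 0" using \<epsilon> by (simp add: c_def add_nonneg_pos)
  have "norm z + 1 > 0" by (simp add: add_nonneg_pos)
  then have cz: "c * norm z \<le> \<epsilon>" using \<epsilon> by (simp add: c_def pos_divide_le_eq)
  have inward: "\<Delta>' (y + c *\<^sub>R z) $ i > 0" if "\<Delta> p $ i = 0" for i
    using y[OF that] z[OF that] c linear_add[OF has_derivative_linear[OF \<Delta>']]
      linear_scale[OF has_derivative_linear[OF \<Delta>']] by (simp add: add_nonneg_pos)
  have "\<forall>\<^sub>F h in at_right 0. p + h *\<^sub>R (y + c *\<^sub>R z) \<in> A \<and> (\<forall>i. \<Delta> (p + h *\<^sub>R (y + c *\<^sub>R z)) $ i \<ge> 0)"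
    by (rule inward_direction_feasible[OF assms(1-4)]) (rule inward)
  from this eventually_at_right_less[of 0]
  show ?thesis
  proof eventually_elim
    case (elim h)
    have "dist (p + h *\<^sub>R y) (p + h *\<^sub>R (y + c *\<^sub>R z)) = h * (c * norm z)"
      using elim(2) c by (simp add: dist_norm scaleR_add_right)
    also have "\<dots> \<le> h * \<epsilon>" using cz elim(2) by (intro mult_left_mono) auto
    finally show ?case using elim(1) by (intro infdist_le2[of "p + h *\<^sub>R (y + c *\<^sub>R z)"]) auto
  qed
qed

section \<open>Margin rates as derivatives along the augmented dynamics\<close>

lemma partial_x_eq:
  assumes "(\<Delta> has_derivative \<Delta>') (at (x, v))"
  shows "partial_x \<Delta> i x v a = \<Delta>' (a, 0) $ i"
proof -
  have "((\<lambda>\<xi>. (\<xi>, v)) has_derivative (\<lambda>a. (a, 0))) (at x)"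
    by (auto intro!: derivative_eq_intros)
  from has_derivative_compose[OF this, of \<Delta> \<Delta>'] assms
  have "((\<lambda>\<xi>. \<Delta> (\<xi>, v) $ i) has_derivative (\<lambda>a. \<Delta>' (a, 0) $ i)) (at x)"
    by (auto intro: bounded_linear.has_derivative[OF bounded_linear_vec_nth])
  then show ?thesis unfolding partial_x_def by (simp flip: frechet_derivative_at)
qed

lemma partial_v_eq:
  assumes "(\<Delta> has_derivative \<Delta>') (at (x, v))"
  shows "partial_v \<Delta> i x v b = \<Delta>' (0, b) $ i"
proof -
  have "((\<lambda>\<nu>. (x, \<nu>)) has_derivative (\<lambda>b. (0, b))) (at v)"
    by (auto intro!: derivative_eq_intros)
  from has_derivative_compose[OF this, of \<Delta> \<Delta>'] assms
  have "((\<lambda>\<nu>. \<Delta> (x, \<nu>) $ i) has_derivative (\<lambda>b. \<Delta>' (0, b) $ i)) (at v)"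
    by (auto intro: bounded_linear.has_derivative[OF bounded_linear_vec_nth])
  then show ?thesis unfolding partial_v_def by (simp flip: frechet_derivative_at)
qed

text \<open>Linearity merges the two partial derivatives. In this form, viability of an input is a
  condition on the closed-loop velocity.\<close>

lemma margin_rate_eq:
  assumes "(\<Delta> has_derivative \<Delta>') (at (x, v))"
  shows "margin_rate f g \<Delta> i x v u w = \<Delta>' (f x + g x *v u, w) $ i"
proof -
  have "\<Delta>' (f x + g x *v u, w) = \<Delta>' (f x + g x *v u, 0) + \<Delta>' (0, w)"
    using linear_add[OF has_derivative_linear[OF assms], of "(f x + g x *v u, 0)" "(0, w)"] by simp
  then show ?thesis
    unfolding margin_rate_def partial_x_eq[OF assms] partial_v_eq[OF assms] by simp
qed

lemma mem_viable_inputs_iff: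
  "(u, w) \<in> viable_inputs f g U \<Delta> \<alpha> x v \<longleftrightarrow>
     u \<in> U \<and> (\<forall>i. margin_rate f g \<Delta> i x v u w + \<alpha> (\<Delta> (x, v) $ i) \<ge> 0)"
  unfolding viable_inputs_def by (auto simp: Min_ge_iff)

text \<open>Bundles both equations into one field on the product space, where the results on
  ordinary differential equations apply.\<close>

definition closed_loop ::
    "(real^'n \<Rightarrow> real^'n) \<Rightarrow> (real^'n \<Rightarrow> real^'m^'n)
      \<Rightarrow> ((real^'n) \<times> (real^'l) \<Rightarrow> (real^'m) \<times> (real^'l)) \<Rightarrow> (real^'n) \<times> (real^'l) \<Rightarrow> (real^'n) \<times> (real^'l)"
  where "closed_loop f g \<beta> p = (f (fst p) + g (fst p) *v fst (\<beta> p), snd (\<beta> p))"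

lemma closed_loop_trajectory_iff:
  "closed_loop_trajectory f g C \<beta> I x v \<longleftrightarrow>
     (\<forall>t\<in>I. (x t, v t) \<in> C) \<and> ode_solution (closed_loop f g \<beta>) I (\<lambda>t. (x t, v t))"
proof -
  have "((\<lambda>t. (x t, v t)) has_vector_derivative (a, b)) (at t within I) \<longleftrightarrow>
      (x has_vector_derivative a) (at t within I) \<and> (v has_vector_derivative b) (at t within I)" for a b t
    using bounded_linear.has_vector_derivative[OF bounded_linear_fst, of "\<lambda>t. (x t, v t)" "(a, b)" "at t within I"]
      bounded_linear.has_vector_derivative[OF bounded_linear_snd, of "\<lambda>t. (x t, v t)" "(a, b)" "at t within I"]
    by (auto intro: has_vector_derivative_Pair)
  then show ?thesis
    unfolding closed_loop_trajectory_def ode_solution_def closed_loop_def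
    by (auto simp: case_prod_beta)
qed

text \<open>Compactness does two things: it turns the local Lipschitz bounds into global ones, and
  it bounds the factors of the product of \<open>g\<close> with the input.\<close>

lemma lipschitz_on_closed_loop:
  assumes f: "locally_lipschitz_on UNIV f" and g: "locally_lipschitz_on UNIV g"
    and \<beta>: "locally_lipschitz_on C \<beta>" and "compact C"
  obtains L where "L-lipschitz_on C (closed_loop f g \<beta>)"
proof -
  have fstC: "compact (fst ` C)"
    using \<open>compact C\<close> by (intro compact_continuous_image continuous_on_fst continuous_on_id)
  obtain Lf where Lf: "Lf-lipschitz_on (fst ` C) f"
    using locally_lipschitz_on_compact[OF locally_lipschitz_on_subset[OF f] fstC] by auto
  obtain Lg where Lg: "Lg-lipschitz_on (fst ` C) g"
    using locally_lipschitz_on_compact[OF locally_lipschitz_on_subset[OF g] fstC] by auto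
  obtain Lb where Lb: "Lb-lipschitz_on C \<beta>"
    using locally_lipschitz_on_compact[OF \<beta> \<open>compact C\<close>] .
  note f' = lipschitz_on_compose2[OF lipschitz_on_fst Lf]
  note g' = lipschitz_on_compose2[OF lipschitz_on_fst Lg]
  note u = lipschitz_on_compose2[OF Lb lipschitz_on_fst]
  note w = lipschitz_on_compose2[OF Lb lipschitz_on_snd]
  have bdd: "bounded (h ` C)" if "N-lipschitz_on C h" for N and h :: "_ \<Rightarrow> 'z::metric_space"
    using compact_continuous_image[OF lipschitz_on_continuous_on[OF that] \<open>compact C\<close>]
    by (rule compact_imp_bounded)
  obtain N where "N-lipschitz_on C (\<lambda>p. g (fst p) *v fst (\<beta> p))"
    using bounded_bilinear.lipschitz_on_prod[OF bounded_bilinear_matrix_vector_mult g' bdd[OF g'] u bdd[OF u]] .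
  from lipschitz_on_Pair[OF lipschitz_on_add[OF f' this] w]
  show thesis by (intro that) (simp add: closed_loop_def[abs_def])
qed

theorem theorem5:
  fixes f :: "real^'n \<Rightarrow> real^'n"
    and g :: "real^'n \<Rightarrow> real^'m^'n"
    and X :: "(real^'n) set"
    and U :: "(real^'m) set"
    and xbar :: "real^'l \<Rightarrow> real^'n"
    and ubar :: "real^'l \<Rightarrow> real^'m"
    and pol :: "real^'n \<Rightarrow> real^'l \<Rightarrow> real^'m"
    and D :: "real^'l \<Rightarrow> (real^'n) set"
    and \<Delta> :: "(real^'n) \<times> (real^'l) \<Rightarrow> real^'c"
    and \<eta> :: real
    and r :: "real^'l"
    and \<kappa> :: "real^'n \<Rightarrow> real^'l \<Rightarrow> real^'m"
    and \<rho> :: "real^'l \<Rightarrow> real^'l \<Rightarrow> real^'l"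
  assumes f_lipschitz: "locally_lipschitz_on UNIV f"
    and g_lipschitz: "locally_lipschitz_on UNIV g"
    and X_closed: "closed X"
    and U_closed: "closed U"
    and xbar_continuous: "continuous_on UNIV xbar"
    and ubar_continuous: "continuous_on UNIV ubar"
    and equilibria: "\<And>v. f (xbar v) + g (xbar v) *v ubar v = 0"
    and equilibria_manifold: "topological_manifold (range (\<lambda>v. (xbar v, ubar v)))"
    and equilibria_simply_connected: "simply_connected (range (\<lambda>v. (xbar v, ubar v)))"
    and references_nonempty: "admissible_references X U xbar ubar \<noteq> {}"
    and pol_continuous: "continuous_on UNIV (\<lambda>(x, v). pol x v)"
    and pol_lipschitz: "\<And>v. locally_lipschitz_on UNIV (\<lambda>x. pol x v)"
    and pol_equilibria: "\<And>v. pol (xbar v) v = ubar v"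
    and pol_stabilizing:
      "\<And>v. asymptotically_stable_equilibrium (\<lambda>x. prestabilized f g pol x v) (xbar v)"
    and D_open: "\<And>v. open (D v)"
    and D_contains: "\<And>v. xbar v \<in> D v"
    and D_attracted:
      "\<And>v x\<^sub>0. x\<^sub>0 \<in> D v \<Longrightarrow> solutions_converge (\<lambda>x. prestabilized f g pol x v) x\<^sub>0 (xbar v)"
    and attraction_domain_open: "open (attraction_domain D)"
    and \<eta>_positive: "\<eta> > 0"
    and \<rho>_navigation: "navigation_field \<rho> r"
    and \<Delta>_margin: "dynamic_safety_margin f g X U xbar ubar pol D \<Delta>"
  shows "\<exists>\<alpha>. class_K \<alpha> \<and>
    (\<forall>(x, v) \<in> safe_set D \<Delta>. viable_inputs f g U \<Delta> \<alpha> x v \<noteq> {}) \<and>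
    (\<forall>\<beta>. is_argmin_policy f g U D \<Delta> \<alpha> \<eta> \<kappa> \<rho> r \<beta> \<and>
         locally_lipschitz_on (safe_set D \<Delta>) \<beta> \<and> satisfies_MFCQ D \<Delta> \<longrightarrow>
       (\<forall>(x\<^sub>0, v\<^sub>0) \<in> safe_set D \<Delta>.
          \<exists>x v. x 0 = x\<^sub>0 \<and> v 0 = v\<^sub>0 \<and>
            closed_loop_trajectory f g (safe_set D \<Delta>) \<beta> {0..} x v \<and>
            (\<forall>I y w. initial_interval I \<and> y 0 = x\<^sub>0 \<and> w 0 = v\<^sub>0 \<and>
               closed_loop_trajectory f g (safe_set D \<Delta>) \<beta> I y w \<longrightarrow>
               (\<forall>t\<in>I. y t = x t \<and> w t = v t)) \<and>
            (\<forall>t\<ge>0. x t \<in> X \<and> v t \<in> admissible_references X U xbar ubar)))"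
proof -
  let ?A = "attraction_domain D" and ?C = "safe_set D \<Delta>"
  obtain \<Delta>' where \<Delta>': "\<And>p. p \<in> ?A \<Longrightarrow> (\<Delta> has_derivative blinfun_apply (\<Delta>' p)) (at p)"
    and cont_\<Delta>': "continuous_on ?A \<Delta>'"
    using \<Delta>_margin unfolding dynamic_safety_margin_def continuously_differentiable_on_def by blast
  have C_sub: "?C \<subseteq> constraint_set X U xbar ubar pol" and C_compact: "compact ?C"
    and margin: "\<And>i x v. (x, v) \<in> ?A \<Longrightarrow> \<Delta> (x, v) $ i = 0 \<Longrightarrow>
      partial_x \<Delta> i x v (prestabilized f g pol x v) \<ge> 0"
    using \<Delta>_margin unfolding dynamic_safety_margin_def by auto
  have CA: "?C \<subseteq> ?A" and C_nonneg: "\<And>p i. p \<in> ?C \<Longrightarrow> \<Delta> p $ i \<ge> 0"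
    by (auto simp: safe_set_def)

  \<comment> \<open>The velocity of the augmented state under the input \<open>(pol x v, 0)\<close>\<close>
  define y where "y p = (prestabilized f g pol (fst p) (snd p), 0 :: real^'l)" for p
  \<comment> \<open>Pairs of a margin value and the rate at which that margin decreases along
    \<open>y\<close>. A class K function above \<open>K\<close> is exactly what makes the input
    \<open>(pol x v, 0)\<close> viable.\<close>
  define K where "K = (\<Union>i. (\<lambda>p. (\<Delta> p $ i, - blinfun_apply (\<Delta>' p) (y p) $ i)) ` ?C)"
  have cont_f: "continuous_on UNIV f" and cont_g: "continuous_on UNIV g"
    using f_lipschitz g_lipschitz by (auto intro: locally_lipschitz_on_continuous_on)
  have cont_y: "continuous_on ?C y"
    unfolding y_def prestabilized_def
    by (intro continuous_on_Pair continuous_on_add continuous_on_const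
        bounded_bilinear.continuous_on[OF bounded_bilinear_matrix_vector_mult]
        continuous_on_compose2[OF cont_f] continuous_on_compose2[OF cont_g]
        continuous_on_subset[OF pol_continuous[unfolded case_prod_beta]]
        continuous_on_fst continuous_on_id) auto
  have cont_\<Delta>: "continuous_on ?C \<Delta>"
    using CA \<Delta>' by (meson continuous_at_imp_continuous_on has_derivative_continuous subsetD)
  have "compact K"
    unfolding K_def
    by (intro compact_UN compact_continuous_image C_compact continuous_on_Pair continuous_on_minus
        continuous_on_component cont_\<Delta> cont_y continuous_on_subset[OF cont_\<Delta>' CA]
        bounded_bilinear.continuous_on[OF bounded_bilinear_blinfun_apply]) auto
  moreover have "a \<ge> 0" if "(a, b) \<in> K" for a b
    using that C_nonneg by (auto simp: K_def)
  \<comment> \<open>The third condition on a dynamic safety margin: a vanishing component does not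
    decrease under the prestabilizing controller.\<close>
  moreover have "b \<le> 0" if K: "(0, b) \<in> K" for b
  proof -
    obtain i x v where xv: "(x, v) \<in> ?C" "\<Delta> (x, v) $ i = 0"
      and b: "b = - blinfun_apply (\<Delta>' (x, v)) (y (x, v)) $ i"
      using K unfolding K_def by fastforce
    have A: "(x, v) \<in> ?A" using xv(1) CA by blast
    show ?thesis
      using margin[OF A xv(2)] unfolding partial_x_eq[OF \<Delta>'[OF A]] b y_def by simp
  qed
  ultimately obtain \<alpha> where \<alpha>: "class_K \<alpha>" "\<And>a b. (a, b) \<in> K \<Longrightarrow> b \<le> \<alpha> a"
    using class_K_majorant by blast

  have feasible: "(pol x v, 0) \<in> viable_inputs f g U \<Delta> \<alpha> x v" if xv: "(x, v) \<in> ?C" for x v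
    unfolding mem_viable_inputs_iff
  proof (intro conjI allI)
    show "pol x v \<in> U"
      using xv C_sub by (auto simp: constraint_set_def constraint_slice_def)
    fix i
    have "(\<Delta> (x, v) $ i, - blinfun_apply (\<Delta>' (x, v)) (y (x, v)) $ i) \<in> K"
      using xv unfolding K_def by blast
    from \<alpha>(2)[OF this] have "- blinfun_apply (\<Delta>' (x, v)) (y (x, v)) $ i \<le> \<alpha> (\<Delta> (x, v) $ i)" .
    moreover have "margin_rate f g \<Delta> i x v (pol x v) 0 = blinfun_apply (\<Delta>' (x, v)) (y (x, v)) $ i"
      using xv CA by (subst margin_rate_eq[OF \<Delta>']) (auto simp: y_def prestabilized_def)
    ultimately show "margin_rate f g \<Delta> i x v (pol x v) 0 + \<alpha> (\<Delta> (x, v) $ i) \<ge> 0" by linarith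
  qed

  have invariant: "\<exists>x v. x 0 = x\<^sub>0 \<and> v 0 = v\<^sub>0 \<and>
      closed_loop_trajectory f g ?C \<beta> {0..} x v \<and>
      (\<forall>I y w. initial_interval I \<and> y 0 = x\<^sub>0 \<and> w 0 = v\<^sub>0 \<and>
         closed_loop_trajectory f g ?C \<beta> I y w \<longrightarrow> (\<forall>t\<in>I. y t = x t \<and> w t = v t)) \<and>
      (\<forall>t\<ge>0. x t \<in> X \<and> v t \<in> admissible_references X U xbar ubar)"
    if \<beta>: "is_argmin_policy f g U D \<Delta> \<alpha> \<eta> \<kappa> \<rho> r \<beta>" "locally_lipschitz_on ?C \<beta>"
      and MFCQ: "satisfies_MFCQ D \<Delta>" and init: "(x\<^sub>0, v\<^sub>0) \<in> ?C" for \<beta> x\<^sub>0 v\<^sub>0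
  proof -
    let ?F = "closed_loop f g \<beta>"
    obtain L where L: "L-lipschitz_on ?C ?F"
      using lipschitz_on_closed_loop[OF f_lipschitz g_lipschitz \<beta>(2) C_compact] .
    \<comment> \<open>\<open>G\<close> is auxiliary: it supplies a global solution, which turns out
      never to leave the safe set and hence solves the closed loop itself.\<close>
    obtain G M where G: "M-lipschitz_on UNIV G" and G_eq: "\<And>p. p \<in> ?C \<Longrightarrow> G p = ?F p"
      using lipschitz_extension[OF L] init by blast
    have subtangent: "\<forall>\<^sub>F h in at_right 0. infdist (p + h *\<^sub>R G p) ?C \<le> h * \<epsilon>"
      if p: "p \<in> ?C" and \<epsilon>: "\<epsilon> > 0" for p \<epsilon>
    proof -
      have A: "p \<in> ?A" using p CA by blast
      obtain x v where xv: "p = (x, v)" by (cases p)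
      obtain z where z: "\<And>i. \<Delta> p $ i = 0 \<Longrightarrow> frechet_derivative (\<lambda>q. \<Delta> q $ i) (at p) z > 0"
        using MFCQ A unfolding satisfies_MFCQ_def by blast
      have "frechet_derivative (\<lambda>q. \<Delta> q $ i) (at p) = (\<lambda>h. blinfun_apply (\<Delta>' p) h $ i)" for i
        using \<Delta>'[OF A] by (intro frechet_derivative_at[symmetric]
            bounded_linear.has_derivative[OF bounded_linear_vec_nth])
      then have z': "blinfun_apply (\<Delta>' p) z $ i > 0" if "\<Delta> p $ i = 0" for i
        using z[OF that] by simp
      have "\<beta> p \<in> viable_inputs f g U \<Delta> \<alpha> x v"
        using \<beta>(1) p unfolding is_argmin_policy_def is_arg_min_def xv by blast
      then have viable: "margin_rate f g \<Delta> i x v (fst (\<beta> p)) (snd (\<beta> p)) + \<alpha> (\<Delta> p $ i) \<ge> 0" for i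
        by (cases "\<beta> p") (simp add: mem_viable_inputs_iff xv)
      \<comment> \<open>On an active component the term with \<alpha> is
        \<open>\<alpha> 0 = 0\<close>, so viability reduces to a nonnegative margin rate.\<close>
      have "blinfun_apply (\<Delta>' p) (G p) $ i \<ge> 0" if "\<Delta> p $ i = 0" for i
        using viable[of i] \<alpha>(1) that margin_rate_eq[OF \<Delta>'[OF A, unfolded xv], of f g i]
        unfolding G_eq[OF p] by (simp add: closed_loop_def class_K_def xv)
      from subtangent_if_inward[OF attraction_domain_open A \<Delta>'[OF A] C_nonneg[OF p] this z' \<epsilon>]
      show ?thesis unfolding safe_set_def .
    qed
    obtain p where p: "ode_solution G {0..} p" "p 0 = (x\<^sub>0, v\<^sub>0)"
      using lipschitz_ode_solution_exists[OF G] .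
    have pC: "p t \<in> ?C" if "t \<ge> 0" for t
      using nagumo_invariance[OF compact_imp_closed[OF C_compact] G subtangent p(1) _ that] init p(2)
      by simp
    have pF: "ode_solution ?F {0..} p"
      using p(1) pC G_eq unfolding ode_solution_def by simp
    show ?thesis
    proof (intro exI[of _ "\<lambda>t. fst (p t)"] exI[of _ "\<lambda>t. snd (p t)"] conjI allI impI ballI)
      show "closed_loop_trajectory f g ?C \<beta> {0..} (\<lambda>t. fst (p t)) (\<lambda>t. snd (p t))"
        unfolding closed_loop_trajectory_iff using pC pF by simp
      fix t :: real assume "t \<ge> 0"
      then have "p t \<in> constraint_set X U xbar ubar pol" using pC C_sub by blast
      then show "fst (p t) \<in> X" "snd (p t) \<in> admissible_references X U xbar ubar"
        by (auto simp: constraint_set_def constraint_slice_def)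
    next
      fix I y w t
      assume I: "initial_interval I \<and> y 0 = x\<^sub>0 \<and> w 0 = v\<^sub>0 \<and>
        closed_loop_trajectory f g ?C \<beta> I y w" and t: "t \<in> I"
      \<comment> \<open>A competing trajectory may live on any initial interval; the comparison is
        made on the part up to \<open>t\<close>.\<close>
      have sub: "{0..t} \<subseteq> I" "t \<ge> 0"
        using I t mem_is_interval_1_I[of I 0 t] unfolding initial_interval_def by auto
      from I have yw: "\<And>s. s \<in> I \<Longrightarrow> (y s, w s) \<in> ?C" "ode_solution ?F I (\<lambda>s. (y s, w s))"
        unfolding closed_loop_trajectory_iff by auto
      \<comment> \<open>Both curves stay in the safe set, the competitor by the definition of a
        trajectory, so the Lipschitz bound \<open>L\<close> of the closed loop there
        suffices.\<close>
      have "(y t, w t) = p t"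
      proof (rule lipschitz_ode_solution_unique[OF L sub(2)])
        show "ode_solution ?F {0..t} (\<lambda>s. (y s, w s))" by (rule ode_solution_subset[OF yw(2) sub(1)])
        show "ode_solution ?F {0..t} p" by (rule ode_solution_subset[OF pF]) auto
      qed (use yw(1) sub pC I p(2) in auto)
      then show "y t = fst (p t)" "w t = snd (p t)" by (simp_all add: prod_eq_iff)
    qed (simp_all add: p(2))
  qed
  show ?thesis
  proof (rule exI[of _ \<alpha>], intro conjI \<alpha>(1) allI impI)
    show "\<forall>(x, v)\<in>?C. viable_inputs f g U \<Delta> \<alpha> x v \<noteq> {}"
      using feasible by fastforce
  qed (elim conjE, rule ballI, unfold split_paired_all prod.case, rule invariant)
qed

end
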